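(* Let $1<p<\infty$, let $\theta_1,\theta_2$ be inner functions and let $h_+\in\mathcal{G}H_\infty^+$ be such that $K_{\theta_1}=h_+K_{\theta_2}$. Then $\phi_+$ is a maximal function for $K_{\theta_1}$ if and only if $\phi_+=h_+\psi_+$, where $\psi_+$ is a maximal function for $K_{\theta_2}$.
   Context: $H_p^\pm=H^p(\mathbb{C}^\pm)$ are the Hardy spaces of the upper/lower half-plane, identified via boundary values with closed subspaces of $L_p=L^p(\mathbb{R})$; $H_\infty^\pm=H^\infty(\mathbb{C}^\pm)$, $L_\infty=L^\infty(\mathbb{R})$, and $\mathcal{G}H_\infty^+$ is the set of invertible elements of $H_\infty^+$. $P^+:L_p\to H_p^+$ is the projection with kernel $H_p^-$; for $g\in L_\infty$ the Toeplitz operator is $T_gf_+=P^+(gf_+)$ on $H_p^+$, so $\ker T_g=\{f_+\in H_p^+: gf_+\in H_p^-\}$. A T-kernel is a set of the form $\ker T_g$ with $g\in L_\infty$. For an inner function $\theta$ (i.e. $\theta\in H_\infty^+$, $|\theta|=1$ a.e. on $\mathbb{R}$), the model space is $K_\theta:=H_p^+\cap\theta H_p^-=\ker T_{\overline\theta}$. For $\phi_+\in H_p^+\setminus\{0\}$, $\mathcal{K}_{\min}(\phi_+)$ denotes the smallest T-kernel containing $\phi_+$: it is a T-kernel containing $\phi_+$, and for any $g\in L_\infty$, $\phi_+\in\ker T_g$ implies $\mathcal{K}_{\min}(\phi_+)\subset\ker T_g$. It is known to exist, and if $\phi_+=I_+O_+$ is an inner-outer factorisation then $\mathcal{K}_{\min}(\phi_+)=\ker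 T_{\overline{I}_+\overline{O}_+/O_+}$. If $K=\mathcal{K}_{\min}(\phi_+)$, then $\phi_+$ is called a maximal function for $K$. *)

theory Defs
  imports "HOL-Complex_Analysis.Complex_Analysis"
begin

text \<open>
  Elements of \<open>L\<^sub>p\<close> and \<open>L\<^sub>\<infinity>\<close> are represented by Lebesgue measurable functions on the real line.
  Functions that agree almost everywhere represent the same element: all sets of functions below
  are closed under equality a.e., and every equation between elements is an equation a.e.
\<close>

definition Lp :: "real \<Rightarrow> (real \<Rightarrow> complex) set" where
  "Lp p = {f \<in> borel_measurable lebesgue. integrable lebesgue (\<lambda>x. norm (f x) powr p)}"

definition Linf :: "(real \<Rightarrow> complex) set" where
  "Linf = {g \<in> borel_measurable lebesgue. \<exists>C::real. AE x in lebesgue. norm (g x) \<le> C}"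

definition upper_half_plane :: "complex set" where
  "upper_half_plane = {z. Im z > 0}"

definition lower_half_plane :: "complex set" where
  "lower_half_plane = {z. Im z < 0}"

text \<open>
  \<open>f\<close> is the nontangential boundary function of \<open>F\<close>; here \<open>S\<close> is the upper or the lower
  half-plane and \<open>a\<close> is the aperture of the approach region at \<open>x\<close>.
\<close>

definition has_boundary_values ::
    "complex set \<Rightarrow> (complex \<Rightarrow> complex) \<Rightarrow> (real \<Rightarrow> complex) \<Rightarrow> bool" where
  "has_boundary_values S F f \<longleftrightarrow>
     (AE x in lebesgue. \<forall>a>0.
        (F \<longlongrightarrow> f x) (at (complex_of_real x) within {z \<in> S. \<bar>Re z - x\<bar> < a * \<bar>Im z\<bar>}))"

text \<open>
  Hardy spaces of the half-plane \<open>S\<close>, as spaces of boundary functions. The set \<open>Im ` S\<close> consists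
  of the heights of the horizontal lines contained in \<open>S\<close>.
\<close>

definition Hardy :: "real \<Rightarrow> complex set \<Rightarrow> (real \<Rightarrow> complex) set" where
  "Hardy p S = {f \<in> Lp p. \<exists>F. F holomorphic_on S \<and>
     (\<exists>C::real. \<forall>y \<in> Im ` S. (\<integral>\<^sup>+ x. ennreal (norm (F (Complex x y)) powr p) \<partial>lborel) \<le> ennreal C) \<and>
     has_boundary_values S F f}"

definition Hardy_inf :: "complex set \<Rightarrow> (real \<Rightarrow> complex) set" where
  "Hardy_inf S = {f \<in> Linf. \<exists>F. F holomorphic_on S \<and> bounded (F ` S) \<and> has_boundary_values S F f}"

abbreviation Hp_plus :: "real \<Rightarrow> (real \<Rightarrow> complex) set" where
  "Hp_plus p \<equiv> Hardy p upper_half_plane"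

abbreviation Hp_minus :: "real \<Rightarrow> (real \<Rightarrow> complex) set" where
  "Hp_minus p \<equiv> Hardy p lower_half_plane"

abbreviation Hinf_plus :: "(real \<Rightarrow> complex) set" where
  "Hinf_plus \<equiv> Hardy_inf upper_half_plane"

definition GHinf_plus :: "(real \<Rightarrow> complex) set" where
  "GHinf_plus = {h \<in> Hinf_plus. \<exists>k \<in> Hinf_plus. AE x in lebesgue. h x * k x = 1}"

definition inner_function :: "(real \<Rightarrow> complex) \<Rightarrow> bool" where
  "inner_function \<theta> \<longleftrightarrow> \<theta> \<in> Hinf_plus \<and> (AE x in lebesgue. norm (\<theta> x) = 1)"

text \<open>
  The set \<open>h M\<close>. Closing under equality a.e. is needed, since \<open>h\<close> may vanish on a null set.
\<close>

definition mult_set :: "(real \<Rightarrow> complex) \<Rightarrow> (real \<Rightarrow> complex) set \<Rightarrow> (real \<Rightarrow> complex) set" where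
  "mult_set h M = {f. \<exists>m \<in> M. AE x in lebesgue. f x = h x * m x}"

text \<open>
  The projection of \<open>L\<^sub>p\<close> onto \<open>H\<^sub>p\<^sup>+\<close> with kernel \<open>H\<^sub>p\<^sup>-\<close>, which exists for \<open>1 < p < \<infinity>\<close> as
  \<open>L\<^sub>p = H\<^sub>p\<^sup>+ \<oplus> H\<^sub>p\<^sup>-\<close>. The component in \<open>H\<^sub>p\<^sup>+\<close> is unique only up to equality a.e.; the choice
  operator selects a representative.
\<close>

definition P_plus :: "real \<Rightarrow> (real \<Rightarrow> complex) \<Rightarrow> real \<Rightarrow> complex" where
  "P_plus p f = (SOME u. u \<in> Hp_plus p \<and> (\<lambda>x. f x - u x) \<in> Hp_minus p)"

definition toeplitz :: "real \<Rightarrow> (real \<Rightarrow> complex) \<Rightarrow> (real \<Rightarrow> complex) \<Rightarrow> real \<Rightarrow> complex" where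
  "toeplitz p g f = P_plus p (\<lambda>x. g x * f x)"

definition ker_toeplitz :: "real \<Rightarrow> (real \<Rightarrow> complex) \<Rightarrow> (real \<Rightarrow> complex) set" where
  "ker_toeplitz p g = {f \<in> Hp_plus p. AE x in lebesgue. toeplitz p g f x = 0}"

definition T_kernel :: "real \<Rightarrow> (real \<Rightarrow> complex) set \<Rightarrow> bool" where
  "T_kernel p K \<longleftrightarrow> (\<exists>g \<in> Linf. K = ker_toeplitz p g)"

definition model_space :: "real \<Rightarrow> (real \<Rightarrow> complex) \<Rightarrow> (real \<Rightarrow> complex) set" where
  "model_space p \<theta> = Hp_plus p \<inter> mult_set \<theta> (Hp_minus p)"

text \<open>\<open>K\<close> is the smallest T-kernel containing \<open>\<phi>\<close>.\<close>

definition is_K_min :: "real \<Rightarrow> (real \<Rightarrow> complex) \<Rightarrow> (real \<Rightarrow> complex) set \<Rightarrow> bool" where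
  "is_K_min p \<phi> K \<longleftrightarrow> T_kernel p K \<and> \<phi> \<in> K \<and>
     (\<forall>g \<in> Linf. \<phi> \<in> ker_toeplitz p g \<longrightarrow> K \<subseteq> ker_toeplitz p g)"

definition maximal_function :: "real \<Rightarrow> (real \<Rightarrow> complex) \<Rightarrow> (real \<Rightarrow> complex) set \<Rightarrow> bool" where
  "maximal_function p \<phi> K \<longleftrightarrow>
     \<phi> \<in> Hp_plus p \<and> \<not> (AE x in lebesgue. \<phi> x = 0) \<and> is_K_min p \<phi> K"

end

theory Submission
  imports Defs
begin

text \<open>
  Multiplication by an invertible \<open>h \<in> H\<^sub>\<infinity>\<^sup>+\<close>, with inverse \<open>k \<in> H\<^sub>\<infinity>\<^sup>+\<close>, is a bijection of \<open>H\<^sub>p\<^sup>+\<close>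
  (up to equality a.e.), and it only moves a factor between symbol and argument of a Toeplitz
  operator: \<open>T\<^bsub>gk\<^esub> (h f) = T\<^sub>g f\<close>, because both sides project the same function \<open>g f\<close>. Hence it
  carries T-kernels to T-kernels, \<open>h ker T\<^sub>g = ker T\<^bsub>gk\<^esub>\<close> (\<open>mult_set_ker_toeplitz\<close>). As every symbol
  arises as some \<open>g k\<close> (to get \<open>g'\<close>, take \<open>g = g' h\<close>), this is an inclusion-preserving bijection of
  the family of all T-kernels onto itself. The T-kernels containing \<open>\<psi>\<close> correspond to those
  containing \<open>h \<psi>\<close>, so the smallest one for \<open>\<psi>\<close> is carried to the smallest one for \<open>h \<psi>\<close>
  (\<open>maximal_function_mult\<close>). Applied to \<open>h\<close> and to \<open>k\<close>, this gives the two implications of the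
  theorem.
\<close>

section \<open>Equality almost everywhere and bounded multipliers\<close>

lemma Lp_cong_AE:
  assumes "f \<in> Lp p" and ae: "AE x in lebesgue. f x = g x"
  shows "g \<in> Lp p"
proof -
  have f: "f \<in> borel_measurable lebesgue" "integrable lebesgue (\<lambda>x. norm (f x) powr p)"
    using assms(1) by (auto simp: Lp_def)
  have g: "g \<in> borel_measurable lebesgue"
    using f(1) ae by (rule borel_measurable_AE)
  have "integrable lebesgue (\<lambda>x. norm (g x) powr p)"
    by (rule integrable_cong_AE_imp[OF f(2)]) (use g ae in auto)
  with g show ?thesis by (simp add: Lp_def)
qed

lemma has_boundary_values_cong_AE:
  assumes "has_boundary_values S F f" and "AE x in lebesgue. f x = g x"
  shows "has_boundary_values S F g"
  using assms unfolding has_boundary_values_def by eventually_elim simp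

lemma has_boundary_values_mult:
  assumes "has_boundary_values S F f" and "has_boundary_values S G g"
  shows "has_boundary_values S (\<lambda>z. F z * G z) (\<lambda>x. f x * g x)"
  using assms unfolding has_boundary_values_def
  by eventually_elim (auto intro: tendsto_mult)

lemma Hardy_cong_AE:
  assumes "f \<in> Hardy p S" and "AE x in lebesgue. f x = g x"
  shows "g \<in> Hardy p S"
  using assms(1) Lp_cong_AE[OF _ assms(2)] has_boundary_values_cong_AE[OF _ assms(2)]
  unfolding Hardy_def by blast

lemma Linf_mult:
  assumes "f \<in> Linf" and "g \<in> Linf"
  shows "(\<lambda>x. f x * g x) \<in> Linf"
proof -
  obtain C D where C: "AE x in lebesgue. norm (f x) \<le> C" and D: "AE x in lebesgue. norm (g x) \<le> D"
    using assms by (auto simp: Linf_def)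
  have "AE x in lebesgue. norm (f x * g x) \<le> \<bar>C\<bar> * \<bar>D\<bar>"
    using C D by eventually_elim (auto simp: norm_mult intro!: mult_mono)
  with assms show ?thesis by (auto simp: Linf_def)
qed

lemma Lp_mult_Linf:
  assumes "0 \<le> p" and "h \<in> Linf" and "f \<in> Lp p"
  shows "(\<lambda>x. h x * f x) \<in> Lp p"
proof -
  obtain C where C: "AE x in lebesgue. norm (h x) \<le> C"
    using assms by (auto simp: Linf_def)
  have [measurable]: "h \<in> borel_measurable lebesgue" "f \<in> borel_measurable lebesgue"
    and f: "integrable lebesgue (\<lambda>x. norm (f x) powr p)"
    using assms by (auto simp: Linf_def Lp_def)
  have "integrable lebesgue (\<lambda>x. norm (h x * f x) powr p)"
  proof (rule Bochner_Integration.integrable_bound)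
    show "integrable lebesgue (\<lambda>x. \<bar>C\<bar> powr p * norm (f x) powr p)"
      using f by simp
    show "AE x in lebesgue. norm (norm (h x * f x) powr p) \<le> norm (\<bar>C\<bar> powr p * norm (f x) powr p)"
      using C by eventually_elim
        (use \<open>0 \<le> p\<close> in \<open>auto simp: norm_mult powr_mult intro!: mult_right_mono powr_mono2\<close>)
  qed measurable
  then show ?thesis by (simp add: Lp_def)
qed

lemma Hp_plus_mult_Hinf_plus:
  assumes "0 \<le> p" and "h \<in> Hinf_plus" and "f \<in> Hp_plus p"
  shows "(\<lambda>x. h x * f x) \<in> Hp_plus p"
proof -
  let ?S = upper_half_plane
  obtain H where H: "H holomorphic_on ?S" "bounded (H ` ?S)" "has_boundary_values ?S H h"
    and h: "h \<in> Linf"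
    using assms(2) by (auto simp: Hardy_inf_def)
  obtain F C where F: "F holomorphic_on ?S" "has_boundary_values ?S F f"
    and C: "\<forall>y \<in> Im ` ?S. (\<integral>\<^sup>+ x. ennreal (norm (F (Complex x y)) powr p) \<partial>lborel) \<le> ennreal C"
    and f: "f \<in> Lp p"
    using assms(3) by (auto simp: Hardy_def)
  obtain B where B: "\<And>z. z \<in> ?S \<Longrightarrow> norm (H z) \<le> B"
    using H(2) by (auto simp: bounded_iff)
  have "(\<integral>\<^sup>+ x. ennreal (norm (H (Complex x y) * F (Complex x y)) powr p) \<partial>lborel)
      \<le> ennreal (B powr p * C)" if y: "y \<in> Im ` ?S" for y
  proof -
    have S: "Complex x y \<in> ?S" for x
      using y by (auto simp: upper_half_plane_def)
    have "continuous_on UNIV (\<lambda>x. F (Complex x y))"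
      by (rule continuous_on_compose2[OF holomorphic_on_imp_continuous_on[OF F(1)]])
        (use S in \<open>auto simp: Complex_eq intro!: continuous_intros\<close>)
    then have [measurable]: "(\<lambda>x. F (Complex x y)) \<in> borel_measurable borel"
      by (rule borel_measurable_continuous_onI)
    have "(\<integral>\<^sup>+ x. ennreal (norm (H (Complex x y) * F (Complex x y)) powr p) \<partial>lborel)
        \<le> (\<integral>\<^sup>+ x. ennreal (B powr p) * ennreal (norm (F (Complex x y)) powr p) \<partial>lborel)"
      using B[OF S] \<open>0 \<le> p\<close>
      by (intro nn_integral_mono)
        (auto simp: norm_mult powr_mult ennreal_mult[symmetric]
          intro!: ennreal_leI mult_right_mono powr_mono2)
    also have "\<dots> = ennreal (B powr p) * (\<integral>\<^sup>+ x. ennreal (norm (F (Complex x y)) powr p) \<partial>lborel)"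
      by (rule nn_integral_cmult) measurable
    also have "\<dots> \<le> ennreal (B powr p) * ennreal C"
      using C y by (intro mult_left_mono) auto
    also have "\<dots> = ennreal (B powr p * C)"
      by (simp add: ennreal_mult')
    finally show ?thesis .
  qed
  moreover have "(\<lambda>z. H z * F z) holomorphic_on ?S"
    using H(1) F(1) by (rule holomorphic_on_mult)
  ultimately have "\<exists>G. G holomorphic_on ?S \<and>
      (\<exists>C. \<forall>y \<in> Im ` ?S. (\<integral>\<^sup>+ x. ennreal (norm (G (Complex x y)) powr p) \<partial>lborel) \<le> ennreal C) \<and>
      has_boundary_values ?S G (\<lambda>x. h x * f x)"
    using has_boundary_values_mult[OF H(3) F(2)]
    by (intro exI[of _ "\<lambda>z. H z * F z"] conjI exI[of _ "B powr p * C"] ballI) assumption+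
  with Lp_mult_Linf[OF assms(1) h f] show ?thesis
    by (simp add: Hardy_def)
qed

section \<open>Multiplying Toeplitz kernels by invertible functions\<close>

text \<open>
  The conclusion is a genuine equality: functions that agree a.e. have the same admissible
  components in \<open>H\<^sub>p\<^sup>+\<close>, so the choice operator selects the same representative.
\<close>

lemma P_plus_cong_AE:
  assumes "AE x in lebesgue. f x = g x"
  shows "P_plus p f = P_plus p g"
proof -
  have "(\<lambda>x. f x - u x) \<in> Hp_minus p \<longleftrightarrow> (\<lambda>x. g x - u x) \<in> Hp_minus p" for u
  proof
    assume "(\<lambda>x. f x - u x) \<in> Hp_minus p"
    then show "(\<lambda>x. g x - u x) \<in> Hp_minus p"
      by (rule Hardy_cong_AE) (use assms in auto)
  next
    assume "(\<lambda>x. g x - u x) \<in> Hp_minus p"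
    then show "(\<lambda>x. f x - u x) \<in> Hp_minus p"
      by (rule Hardy_cong_AE) (use assms in auto)
  qed
  then show ?thesis by (simp add: P_plus_def)
qed

lemma toeplitz_cong_AE:
  assumes "AE x in lebesgue. g x * f x = g' x * f' x"
  shows "toeplitz p g f = toeplitz p g' f'"
  unfolding toeplitz_def by (rule P_plus_cong_AE) (rule assms)

lemma ker_toeplitz_cong_AE:
  assumes "AE x in lebesgue. g x = g' x"
  shows "ker_toeplitz p g = ker_toeplitz p g'"
proof -
  have "toeplitz p g f = toeplitz p g' f" for f
    by (rule toeplitz_cong_AE) (use assms in auto)
  then show ?thesis by (simp add: ker_toeplitz_def)
qed

lemma mult_setI: "m \<in> M \<Longrightarrow> AE x in lebesgue. f x = h x * m x \<Longrightarrow> f \<in> mult_set h M"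
  by (auto simp: mult_set_def)

text \<open>
  The preimage of \<open>f\<close> under multiplication by \<open>h\<close> is \<open>k f\<close>, and \<open>T\<^sub>g (k f) = T\<^bsub>gk\<^esub> f\<close>.
\<close>

lemma mult_set_ker_toeplitz:
  assumes "0 \<le> p" and "h \<in> Hinf_plus" and "k \<in> Hinf_plus"
    and inv: "AE x in lebesgue. h x * k x = 1"
  shows "mult_set h (ker_toeplitz p g) = ker_toeplitz p (\<lambda>x. g x * k x)"
proof (intro equalityI subsetI)
  fix f assume "f \<in> mult_set h (ker_toeplitz p g)"
  then obtain m where m: "m \<in> Hp_plus p" "AE x in lebesgue. toeplitz p g m x = 0"
    and fm: "AE x in lebesgue. f x = h x * m x"
    by (auto simp: mult_set_def ker_toeplitz_def)
  have "f \<in> Hp_plus p"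
    by (rule Hardy_cong_AE[OF Hp_plus_mult_Hinf_plus[OF assms(1,2) m(1)]]) (use fm in auto)
  moreover have "toeplitz p (\<lambda>x. g x * k x) f = toeplitz p g m"
  proof (rule toeplitz_cong_AE)
    show "AE x in lebesgue. g x * k x * f x = g x * m x"
      using fm inv
    proof eventually_elim
      case (elim x)
      have "g x * k x * f x = g x * m x * (h x * k x)"
        by (simp add: elim(1) ac_simps)
      with elim(2) show ?case by simp
    qed
  qed
  ultimately show "f \<in> ker_toeplitz p (\<lambda>x. g x * k x)"
    using m(2) by (simp add: ker_toeplitz_def)
next
  fix f assume "f \<in> ker_toeplitz p (\<lambda>x. g x * k x)"
  then have f: "f \<in> Hp_plus p" "AE x in lebesgue. toeplitz p (\<lambda>x. g x * k x) f x = 0"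
    by (auto simp: ker_toeplitz_def)
  have "toeplitz p g (\<lambda>x. k x * f x) = toeplitz p (\<lambda>x. g x * k x) f"
    by (rule toeplitz_cong_AE) (simp add: mult.assoc)
  with f have "(\<lambda>x. k x * f x) \<in> ker_toeplitz p g"
    using Hp_plus_mult_Hinf_plus[OF assms(1,3)] by (simp add: ker_toeplitz_def)
  moreover have "AE x in lebesgue. f x = h x * (k x * f x)"
    using inv by eventually_elim (simp add: mult.assoc[symmetric])
  ultimately show "f \<in> mult_set h (ker_toeplitz p g)"
    by (rule mult_setI)
qed

lemma mult_set_mono: "M \<subseteq> N \<Longrightarrow> mult_set h M \<subseteq> mult_set h N"
  by (auto simp: mult_set_def)

text \<open>
  The left-hand side is closed under equality a.e. by construction, so \<open>M\<close> has to be closed as well.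
\<close>

lemma mult_set_inverse:
  assumes inv: "AE x in lebesgue. h x * k x = 1"
    and closed: "\<And>f g. f \<in> M \<Longrightarrow> AE x in lebesgue. f x = g x \<Longrightarrow> g \<in> M"
  shows "mult_set k (mult_set h M) = M"
proof (intro equalityI subsetI)
  fix f assume "f \<in> mult_set k (mult_set h M)"
  then obtain n m where "m \<in> M"
    and n: "AE x in lebesgue. n x = h x * m x" and f: "AE x in lebesgue. f x = k x * n x"
    by (auto simp: mult_set_def)
  have "AE x in lebesgue. m x = f x"
    using n f inv
  proof eventually_elim
    case (elim x)
    have "f x = m x * (h x * k x)"
      by (simp add: elim(1,2) ac_simps)
    with elim(3) show ?case by simp
  qed
  with \<open>m \<in> M\<close> show "f \<in> M" by (rule closed)
next
  fix f assume "f \<in> M"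
  then have "(\<lambda>x. h x * f x) \<in> mult_set h M"
    by (auto simp: mult_set_def)
  moreover have "AE x in lebesgue. f x = k x * (h x * f x)"
    using inv
  proof eventually_elim
    case (elim x)
    have "k x * (h x * f x) = f x * (h x * k x)"
      by (simp add: ac_simps)
    with elim show ?case by simp
  qed
  ultimately show "f \<in> mult_set k (mult_set h M)"
    by (rule mult_setI)
qed

lemma model_space_cong_AE:
  assumes "f \<in> model_space p \<theta>" and ae: "AE x in lebesgue. f x = g x"
  shows "g \<in> model_space p \<theta>"
proof -
  obtain m where m: "m \<in> Hp_minus p" "AE x in lebesgue. f x = \<theta> x * m x"
    using assms(1) by (auto simp: model_space_def mult_set_def)
  have "AE x in lebesgue. g x = \<theta> x * m x"
    using m(2) ae by eventually_elim simp
  then show ?thesis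
    using assms m(1) Hardy_cong_AE by (auto simp: model_space_def mult_set_def)
qed

section \<open>Maximal functions\<close>

text \<open>
  For minimality, a T-kernel \<open>ker T\<^sub>g\<close> containing \<open>h \<psi>\<close> is pulled back to \<open>ker T\<^bsub>gh\<^esub>\<close>, which
  contains \<open>\<psi>\<close> and therefore \<open>N\<close>; multiplication by \<open>h\<close> brings \<open>ker T\<^bsub>gh\<^esub>\<close> back to \<open>ker T\<^sub>g\<close>.
\<close>

lemma maximal_function_mult:
  assumes "0 \<le> p" and h: "h \<in> Hinf_plus" and k: "k \<in> Hinf_plus"
    and inv: "AE x in lebesgue. h x * k x = 1"
    and max: "maximal_function p \<psi> N"
    and eq: "AE x in lebesgue. \<phi> x = h x * \<psi> x"
  shows "maximal_function p \<phi> (mult_set h N)"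
proof -
  have \<psi>: "\<psi> \<in> Hp_plus p" "\<not> (AE x in lebesgue. \<psi> x = 0)" "T_kernel p N" "\<psi> \<in> N"
    and least: "\<And>g. g \<in> Linf \<Longrightarrow> \<psi> \<in> ker_toeplitz p g \<Longrightarrow> N \<subseteq> ker_toeplitz p g"
    using max by (auto simp: maximal_function_def is_K_min_def)
  have Linf: "h \<in> Linf" "k \<in> Linf"
    using h k by (auto simp: Hardy_inf_def)
  note mult_ker = mult_set_ker_toeplitz[OF assms(1) h k inv]
  have "\<phi> \<in> Hp_plus p"
    by (rule Hardy_cong_AE[OF Hp_plus_mult_Hinf_plus[OF assms(1) h \<psi>(1)]]) (use eq in auto)
  moreover have "\<not> (AE x in lebesgue. \<phi> x = 0)"
  proof
    assume "AE x in lebesgue. \<phi> x = 0"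
    with eq inv have "AE x in lebesgue. \<psi> x = 0"
      by eventually_elim auto
    with \<psi>(2) show False ..
  qed
  moreover have "T_kernel p (mult_set h N)"
    using \<psi>(3) Linf_mult[OF _ Linf(2)] mult_ker unfolding T_kernel_def by blast
  moreover have "\<phi> \<in> mult_set h N"
    using \<psi>(4) eq by (auto simp: mult_set_def)
  moreover have "mult_set h N \<subseteq> ker_toeplitz p g"
    if g: "g \<in> Linf" and \<phi>: "\<phi> \<in> ker_toeplitz p g" for g
  proof -
    have "toeplitz p (\<lambda>x. g x * h x) \<psi> = toeplitz p g \<phi>"
      by (rule toeplitz_cong_AE) (use eq in auto)
    with \<phi> \<psi>(1) have "\<psi> \<in> ker_toeplitz p (\<lambda>x. g x * h x)"
      by (simp add: ker_toeplitz_def)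
    then have "N \<subseteq> ker_toeplitz p (\<lambda>x. g x * h x)"
      by (rule least[OF Linf_mult[OF g Linf(1)]])
    then have "mult_set h N \<subseteq> ker_toeplitz p (\<lambda>x. g x * h x * k x)"
      unfolding mult_ker[symmetric] by (rule mult_set_mono)
    also have "\<dots> = ker_toeplitz p g"
      by (rule ker_toeplitz_cong_AE) (use inv in \<open>auto simp: mult.assoc\<close>)
    finally show ?thesis .
  qed
  ultimately show ?thesis
    by (simp add: maximal_function_def is_K_min_def)
qed

theorem theorem5p5:
  fixes p :: real and \<theta>1 \<theta>2 h \<phi> :: "real \<Rightarrow> complex"
  assumes "1 < p"
    and "inner_function \<theta>1" and "inner_function \<theta>2"
    and "h \<in> GHinf_plus"
    and "model_space p \<theta>1 = mult_set h (model_space p \<theta>2)"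
  shows "maximal_function p \<phi> (model_space p \<theta>1) \<longleftrightarrow>
    (\<exists>\<psi>. maximal_function p \<psi> (model_space p \<theta>2) \<and> (AE x in lebesgue. \<phi> x = h x * \<psi> x))"
proof -
  obtain k where h: "h \<in> Hinf_plus" and k: "k \<in> Hinf_plus"
    and inv: "AE x in lebesgue. h x * k x = 1"
    using assms(4) by (auto simp: GHinf_plus_def)
  have inv': "AE x in lebesgue. k x * h x = 1"
    using inv by (simp add: mult.commute)
  have p: "0 \<le> p" using assms(1) by simp
  show ?thesis
  proof
    assume \<phi>: "maximal_function p \<phi> (model_space p \<theta>1)"
    have "maximal_function p (\<lambda>x. k x * \<phi> x) (mult_set k (model_space p \<theta>1))"
      by (rule maximal_function_mult[OF p k h inv' \<phi>]) simp
    also have "mult_set k (model_space p \<theta>1) = model_space p \<theta>2"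
      unfolding assms(5) by (rule mult_set_inverse[OF inv model_space_cong_AE])
    finally have "maximal_function p (\<lambda>x. k x * \<phi> x) (model_space p \<theta>2)" .
    moreover have "AE x in lebesgue. \<phi> x = h x * (k x * \<phi> x)"
      using inv by eventually_elim (simp add: mult.assoc[symmetric])
    ultimately show "\<exists>\<psi>. maximal_function p \<psi> (model_space p \<theta>2) \<and>
        (AE x in lebesgue. \<phi> x = h x * \<psi> x)"
      by blast
  next
    assume "\<exists>\<psi>. maximal_function p \<psi> (model_space p \<theta>2) \<and> (AE x in lebesgue. \<phi> x = h x * \<psi> x)"
    then show "maximal_function p \<phi> (model_space p \<theta>1)"
      unfolding assms(5) using maximal_function_mult[OF p h k inv] by blast
  qed
qed

end
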